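(* Let $0<q_2<q_1<1-q_2$ and $q_S:=1-q_1-q_2$, and let $Y_L<y<Y_F$. Then the solutions of the coordination game described in the context are of three types: (a) If $Y_L<y<Y_1$, the game has three Nash equilibria, given by the two pure strategies $(1,0)$ and $(0,1)$, and one mixed strategy $(P_1(y),P_2(y))$. (b) If $Y_1\le y<Y_2$, the game has one Nash equilibrium, given by the strategies $(1,0)$. (c) If $Y_2\le y<Y_F$, the game has one Nash equilibrium, given by the strategies $(1,1)$.
   Context: Constants: $r\in\mathbb{R}$, $\eta>0$, $\delta>0$, $K>0$, $0<D_2<D_1$; $$\beta:=\Big(\tfrac12-\tfrac{r-\delta}{\eta^2}\Big)+\sqrt{\Big(\tfrac12-\tfrac{r-\delta}{\eta^2}\Big)^2+\tfrac{2r}{\eta^2}}>1,\qquad Y_F:=\frac{\delta K\beta}{D_2(\beta-1)}.$$ For $y>0$: $F(y)=\frac{K}{\beta-1}(y/Y_F)^\beta$ if $y\le Y_F$, $F(y)=\frac{D_2y}{\delta}-K$ if $y>Y_F$; $L(y)=\frac{D_1y}{\delta}-\frac{D_1-D_2}{D_2}\frac{K\beta}{\beta-1}(y/Y_F)^\beta-K$ if $y<Y_F$, $L(y)=\frac{D_2y}{\delta}-K$ if $y\ge Y_F$; $S(y)=\frac{D_2y}{\delta}-K$. $Y_L$ is the unique point of $(0,Y_F)$ such that $S<L<F$ for $y<Y_L$, $S<L=F$ at $Y_L$, $S<F<L$ on $(Y_L,Y_F)$; and $S=F=L$ for $y\ge Y_F$. Let $S_1:=q_1L+q_2F+q_SS$,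 $S_2:=q_2L+q_1F+q_SS$, $p_0(y):=\frac{L(y)-F(y)}{L(y)-S(y)}$ and $P_i(y):=\frac{p_0(y)}{q_ip_0(y)+q_S}$, equivalently $P_1=\frac{L-F}{L-S_2}$ and $P_2=\frac{L-F}{L-S_1}$. $Y_L<Y_1<Y_2<Y_F$ are the points with $S_1(Y_1)=F(Y_1)$ and $S_2(Y_2)=F(Y_2)$. Coordination game at level $y$: a strategy profile is $(p_1,p_2)\in[0,1]^2$ with $\max(p_1,p_2)>0$. In each round agent $i$ exercises with probability $p_i$, independently across agents and rounds; (exercise, exercise) ends the game with payoffs $(S_1(y),S_2(y))$, (exercise, defer) with $(L(y),F(y))$, (defer, exercise) with $(F(y),L(y))$, and (defer, defer) leads to an identical new round. Thus the outcome probabilities are $a_1=\frac{p_1(1-p_2)}{p_1+p_2-p_1p_2}$ (agent one alone exercises), $a_2=\frac{p_2(1-p_1)}{p_1+p_2-p_1p_2}$ (agent two alone), $a_S=\frac{p_1p_2}{p_1+p_2-p_1p_2}$ (both), and the expected payoffs are $E_1=a_1L+a_2F+a_SS_1$, $E_2=a_2L+a_1F+a_SS_2$. A Nash equilibrium is a profile in which each agent's $p_i$ maximizes $E_i$ given the other's.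
   Formalization: The lists are proved for trembling-hand perfect equilibria, and for all Nash equilibria only up to outcome probabilities (not at Y_1, Y_2; literally in (c) for y>Y_2): as stated it fails, since (p,0) with P_1≤p≤1 is also Nash in (a), (b), and ties occur at Y_1, Y_2. *)

theory Defs
  imports "HOL-Analysis.Analysis"
begin

record duopoly =
  rate :: real  (* r *)
  vol :: real  (* eta *)
  yield :: real  (* delta *)
  cost :: real  (* K *)
  D1 :: real
  D2 :: real
  q1 :: real
  q2 :: real

definition qS :: "duopoly \<Rightarrow> real" where
  "qS M = 1 - q1 M - q2 M"

definition beta :: "duopoly \<Rightarrow> real" where
  "beta M = (1/2 - (rate M - yield M) / (vol M)\<^sup>2)
    + sqrt ((1/2 - (rate M - yield M) / (vol M)\<^sup>2)\<^sup>2 + 2 * rate M / (vol M)\<^sup>2)"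

definition Y_F :: "duopoly \<Rightarrow> real" where
  "Y_F M = yield M * cost M * beta M / (D2 M * (beta M - 1))"

(* The three value functions are meaningful for y > 0 only. *)

definition F :: "duopoly \<Rightarrow> real \<Rightarrow> real" where
  "F M y = (if y \<le> Y_F M then cost M / (beta M - 1) * (y / Y_F M) powr beta M
            else D2 M * y / yield M - cost M)"

definition L :: "duopoly \<Rightarrow> real \<Rightarrow> real" where
  "L M y = (if y < Y_F M
            then D1 M * y / yield M
                 - (D1 M - D2 M) / D2 M * (cost M * beta M / (beta M - 1)) * (y / Y_F M) powr beta M
                 - cost M
            else D2 M * y / yield M - cost M)"

definition S :: "duopoly \<Rightarrow> real \<Rightarrow> real" where
  "S M y = D2 M * y / yield M - cost M"

definition S1 :: "duopoly \<Rightarrow> real \<Rightarrow> real" where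
  "S1 M y = q1 M * L M y + q2 M * F M y + qS M * S M y"

definition S2 :: "duopoly \<Rightarrow> real \<Rightarrow> real" where
  "S2 M y = q2 M * L M y + q1 M * F M y + qS M * S M y"

definition Y_L :: "duopoly \<Rightarrow> real" where
  "Y_L M = (THE z. 0 < z \<and> z < Y_F M
     \<and> (\<forall>y. 0 < y \<and> y < z \<longrightarrow> S M y < L M y \<and> L M y < F M y)
     \<and> S M z < L M z \<and> L M z = F M z
     \<and> (\<forall>y. z < y \<and> y < Y_F M \<longrightarrow> S M y < F M y \<and> F M y < L M y))"

definition Y_1 :: "duopoly \<Rightarrow> real" where
  "Y_1 M = (THE z. Y_L M < z \<and> z < Y_F M \<and> S1 M z = F M z)"

definition Y_2 :: "duopoly \<Rightarrow> real" where
  "Y_2 M = (THE z. Y_L M < z \<and> z < Y_F M \<and> S2 M z = F M z)"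

definition p0 :: "duopoly \<Rightarrow> real \<Rightarrow> real" where
  "p0 M y = (L M y - F M y) / (L M y - S M y)"

definition P_1 :: "duopoly \<Rightarrow> real \<Rightarrow> real" where
  "P_1 M y = p0 M y / (q1 M * p0 M y + qS M)"

definition P_2 :: "duopoly \<Rightarrow> real \<Rightarrow> real" where
  "P_2 M y = p0 M y / (q2 M * p0 M y + qS M)"

text \<open>
  A profile consists of the probabilities with which the two agents exercise in each round;
  the profile in which nobody ever exercises is excluded, and it is therefore not available
  as a deviation either.
\<close>

definition profiles :: "(real \<times> real) set" where
  "profiles = {(p, q). 0 \<le> p \<and> p \<le> 1 \<and> 0 \<le> q \<and> q \<le> 1 \<and> max p q > 0}"

definition a1 :: "real \<times> real \<Rightarrow> real" where
  "a1 = (\<lambda>(p, q). p * (1 - q) / (p + q - p * q))"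

definition a2 :: "real \<times> real \<Rightarrow> real" where
  "a2 = (\<lambda>(p, q). q * (1 - p) / (p + q - p * q))"

definition aS :: "real \<times> real \<Rightarrow> real" where
  "aS = (\<lambda>(p, q). p * q / (p + q - p * q))"

definition outcome :: "real \<times> real \<Rightarrow> real \<times> real \<times> real" where
  "outcome s = (a1 s, a2 s, aS s)"

definition E1 :: "duopoly \<Rightarrow> real \<Rightarrow> real \<times> real \<Rightarrow> real" where
  "E1 M y s = a1 s * L M y + a2 s * F M y + aS s * S1 M y"

definition E2 :: "duopoly \<Rightarrow> real \<Rightarrow> real \<times> real \<Rightarrow> real" where
  "E2 M y s = a2 s * L M y + a1 s * F M y + aS s * S2 M y"

definition best_reply1 :: "duopoly \<Rightarrow> real \<Rightarrow> real \<Rightarrow> real \<Rightarrow> bool" where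
  "best_reply1 M y q p \<longleftrightarrow>
     (p, q) \<in> profiles \<and> (\<forall>p'. (p', q) \<in> profiles \<longrightarrow> E1 M y (p', q) \<le> E1 M y (p, q))"

definition best_reply2 :: "duopoly \<Rightarrow> real \<Rightarrow> real \<Rightarrow> real \<Rightarrow> bool" where
  "best_reply2 M y p q \<longleftrightarrow>
     (p, q) \<in> profiles \<and> (\<forall>q'. (p, q') \<in> profiles \<longrightarrow> E2 M y (p, q') \<le> E2 M y (p, q))"

definition nash :: "duopoly \<Rightarrow> real \<Rightarrow> (real \<times> real) set" where
  "nash M y = {(p, q). best_reply1 M y q p \<and> best_reply2 M y p q}"

text \<open>
  Nash equilibria alone do not determine the strategies: against an opponent who never
  exercises, every positive exercise probability yields the payoff \<open>L\<close>, so that together with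
  \<open>(1, 0)\<close> also \<open>(p, 0)\<close> is an equilibrium for all \<open>p < 1\<close> close to \<open>1\<close>, with the same outcome
  probabilities; and where \<open>S1 = F\<close> or \<open>S2 = F\<close>, an agent is indifferent against an opponent
  who exercises for sure. Selten's trembling-hand perfection removes both kinds of ties: the
  equilibrium strategies must also be best replies to completely mixed strategies arbitrarily
  close to the equilibrium strategy of the opponent.
\<close>

definition perfect_nash :: "duopoly \<Rightarrow> real \<Rightarrow> (real \<times> real) set" where
  "perfect_nash M y = {(p, q). (p, q) \<in> nash M y \<and>
     (\<exists>u v. (\<forall>n::nat. 0 < u n \<and> u n < 1 \<and> 0 < v n \<and> v n < 1) \<and> u \<longlonglongrightarrow> p \<and> v \<longlonglongrightarrow> q
        \<and> (\<forall>n. best_reply1 M y (v n) p \<and> best_reply2 M y (u n) q))}"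

end

theory Submission
  imports Defs "HOL-Real_Asymp.Real_Asymp"
begin

text \<open>
  In the variable \<open>y / Y_F\<close>, each of \<open>L - F\<close>, \<open>S1 - F\<close> and \<open>S2 - F\<close> has the form
  \<open>A x - B x\<^sup>\<beta> - C\<close> with \<open>A = B + C\<close> and \<open>A < \<beta> B\<close>: it vanishes at \<open>1\<close>, where it decreases,
  and is increasing and then decreasing on \<open>[0, 1]\<close>, so it changes sign exactly once inside,
  from minus to plus. This locates \<open>Y_L < Y_1 < Y_2\<close>.
  In the game, the gain of an agent over \<open>F\<close> against an opponent who exercises with probability
  \<open>q > 0\<close> is a strictly increasing function of the own probability times \<open>(L - F) - q (L - S\<^sub>i)\<close>,
  so the best reply is \<open>1\<close>, arbitrary or \<open>0\<close> as \<open>q\<close> lies below, at or above the threshold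
  \<open>(L - F) / (L - S\<^sub>i)\<close>, which is \<open>P_2\<close> for agent one and \<open>P_1\<close> for agent two. The equilibria are
  read off from the position of the two thresholds relative to \<open>1\<close>.
\<close>

section \<open>Single crossing\<close>

lemma powr_unimodal_crossing:
  fixes A B C b :: real
  assumes b: "1 < b" and B: "0 < B" and C: "0 < C" and A: "A = B + C" and slope: "A < b * B"
  defines "g \<equiv> \<lambda>x. A * x - B * x powr b - C"
  shows "\<exists>z. 0 < z \<and> z < 1 \<and> (\<forall>x. 0 < x \<and> x < z \<longrightarrow> g x < 0) \<and> g z = 0
    \<and> (\<forall>x. z < x \<and> x < 1 \<longrightarrow> 0 < g x)"
proof -
  \<comment> \<open>The only zero of the derivative of \<open>g\<close> on the positive axis;
    \<open>slope\<close> puts it below \<open>1\<close>.\<close>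
  define m where "m = (A / (b * B)) powr (1 / (b - 1))"
  have ratio: "0 < A / (b * B)" "A / (b * B) < 1"
    using assms by auto
  have m: "0 < m" "m < 1"
    using ratio b powr_less_mono2[of "1 / (b - 1)" "A / (b * B)" 1] by (auto simp: m_def)
  have m_powr: "m powr (b - 1) = A / (b * B)"
  proof -
    have "1 / (b - 1) * (b - 1) = 1" using b by simp
    then show ?thesis
      using ratio(1) by (simp only: m_def powr_powr powr_one less_imp_le)
  qed
  have deriv: "(g has_real_derivative A - B * (b * x powr (b - 1))) (at x)" if "0 < x" for x
    unfolding g_def using that by (auto intro!: derivative_eq_intros)
  have cont: "continuous_on {u..v} g" if "0 \<le> u" for u v
    unfolding g_def using that b by (intro continuous_intros continuous_on_powr') auto
  have inc: "g u < g v" if "0 \<le> u" "u < v" "v \<le> m" for u v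
  proof (rule DERIV_pos_imp_increasing_open[OF \<open>u < v\<close>])
    fix x assume x: "u < x" "x < v"
    have "x powr (b - 1) < A / (b * B)"
      using x that b powr_less_mono2[of "b - 1" x m] by (simp add: m_powr)
    then show "\<exists>D. (g has_real_derivative D) (at x) \<and> 0 < D"
      using x that b B deriv[of x] by (intro exI[of _ "A - B * (b * x powr (b - 1))"])
        (auto simp: field_simps)
  qed (use cont that in auto)
  have dec: "g v < g u" if "m \<le> u" "u < v" for u v
  proof (rule DERIV_neg_imp_decreasing_open[OF \<open>u < v\<close>])
    fix x assume x: "u < x" "x < v"
    have "A / (b * B) < x powr (b - 1)"
      using x that m b powr_less_mono2[of "b - 1" m x] by (simp add: m_powr)
    then show "\<exists>D. (g has_real_derivative D) (at x) \<and> D < 0"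
      using x that m b B deriv[of x] by (intro exI[of _ "A - B * (b * x powr (b - 1))"])
        (auto simp: field_simps)
  qed (use cont that m in auto)
  have g1: "g 1 = 0" and g0: "g 0 < 0"
    using A C by (auto simp: g_def)
  \<comment> \<open>\<open>g\<close> falls strictly on \<open>[m, 1]\<close> and ends at
    \<open>0\<close>, so the sign change is left to the rising branch.\<close>
  have gm: "0 < g m"
    using dec[of m 1] m g1 by simp
  obtain z where z: "0 \<le> z" "z \<le> m" "g z = 0"
    using IVT'[of g 0 0 m] g0 gm m cont[of 0 m] by auto
  have z': "0 < z" "z < m"
    using z g0 gm by (auto simp: less_le)
  have "g x < 0" if "0 < x" "x < z" for x
    using inc[of x z] that z by simp
  moreover have "0 < g x" if "z < x" "x < 1" for x
  proof (cases "x \<le> m")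
    case True
    then show ?thesis using inc[of z x] that z by simp
  next
    case False
    then show ?thesis using dec[of x 1] that g1 by simp
  qed
  ultimately show ?thesis
    using z z' m by (intro exI[of _ z]) auto
qed

text \<open>Strict convexity of \<open>x powr b\<close>. In scaled form this becomes the gap between
  \<open>F\<close> and \<open>S\<close>.\<close>

lemma powr_gt_tangent:
  fixes x b :: real
  assumes "1 < b" "0 < x" "x < 1"
  shows "b * x - (b - 1) < x powr b"
proof -
  have "(\<lambda>x. b * x - x powr b) x < (\<lambda>x. b * x - x powr b) 1"
  proof (rule DERIV_pos_imp_increasing_open[OF \<open>x < 1\<close>])
    fix t assume t: "x < t" "t < 1"
    have "t powr (b - 1) < 1"
      using t assms powr_less_mono2[of "b - 1" t 1] by simp
    then show "\<exists>D. ((\<lambda>x. b * x - x powr b) has_real_derivative D) (at t) \<and> 0 < D"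
      using t assms by (intro exI[of _ "b - b * t powr (b - 1)"])
        (auto intro!: derivative_eq_intros)
  next
    show "continuous_on {x..1} (\<lambda>x. b * x - x powr b)"
      using assms by (intro continuous_intros) auto
  qed
  then show ?thesis by simp
qed

section \<open>Best replies\<close>

lemma repeated_game_best_reply_iff:
  fixes l f s q p :: real
  defines "V \<equiv> \<lambda>p. (p * (1 - q) * l + q * (1 - p) * f + p * q * s) / (p + q - p * q)"
  assumes s: "s < l" and q: "0 < q" "q \<le> 1" and p: "0 \<le> p" "p \<le> 1"
  shows "(\<forall>p'. 0 \<le> p' \<and> p' \<le> 1 \<longrightarrow> V p' \<le> V p) \<longleftrightarrow>
    (q < (l - f) / (l - s) \<longrightarrow> p = 1) \<and> ((l - f) / (l - s) < q \<longrightarrow> p = 0)"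
proof -
  \<comment> \<open>\<open>A\<close> is the expected gain over \<open>f\<close> given that this
    agent exercises in the deciding round, \<open>(1 - q) * l + q * s - f\<close>;
    \<open>w p\<close> is the probability of that event.\<close>
  define A where "A = (l - f) - q * (l - s)"
  define w where "w = (\<lambda>p. p / (p + q - p * q))"
  have den: "0 < t + q - t * q" if "0 \<le> t" for t
  proof -
    have "0 \<le> t * (1 - q)" using that q by simp
    then show ?thesis using q by (simp add: algebra_simps)
  qed
  have V: "V t = f + w t * A" if "0 \<le> t" for t
    using den[OF that] by (simp add: V_def w_def A_def field_simps)
  \<comment> \<open>The denominator is \<open>q + t * (1 - q)\<close>, and \<open>q > 0\<close>
    makes the quotient strictly increasing.\<close>
  have w_mono: "w t < w t'" if "0 \<le> t" "t < t'" for t t'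
    using den[of t] den[of t'] that q by (simp add: w_def divide_simps) (simp add: algebra_simps)
  have A_pos: "q < (l - f) / (l - s) \<longleftrightarrow> 0 < A" and A_neg: "(l - f) / (l - s) < q \<longleftrightarrow> A < 0"
    using s by (auto simp: A_def field_simps)
  have le_iff: "V t \<le> V p \<longleftrightarrow> w t * A \<le> w p * A" if "0 \<le> t" for t
    using V[OF that] V[OF p(1)] by simp
  show ?thesis
  proof (cases A "0 :: real" rule: linorder_cases)
    case less
    have "(\<forall>t. 0 \<le> t \<and> t \<le> 1 \<longrightarrow> V t \<le> V p) \<longleftrightarrow> p = 0"
    proof
      assume *: "\<forall>t. 0 \<le> t \<and> t \<le> 1 \<longrightarrow> V t \<le> V p"
      then have "w p \<le> w 0" using le_iff[of 0] less by (auto simp: mult_le_cancel_right)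
      then show "p = 0" using w_mono[of 0 p] p by (cases "p = 0") auto
    next
      assume "p = 0"
      then have "w p \<le> w t" if "0 \<le> t" for t using w_mono[of 0 t] that by (cases "t = 0") auto
      then show "\<forall>t. 0 \<le> t \<and> t \<le> 1 \<longrightarrow> V t \<le> V p"
        using le_iff less by (auto simp: mult_le_cancel_right)
    qed
    then show ?thesis using less by (simp add: A_pos A_neg)
  next
    case equal
    then show ?thesis using le_iff by (simp add: A_pos A_neg)
  next
    case greater
    have "(\<forall>t. 0 \<le> t \<and> t \<le> 1 \<longrightarrow> V t \<le> V p) \<longleftrightarrow> p = 1"
    proof
      assume *: "\<forall>t. 0 \<le> t \<and> t \<le> 1 \<longrightarrow> V t \<le> V p"
      then have "w 1 \<le> w p" using le_iff[of 1] greater by (auto simp: mult_le_cancel_right)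
      then show "p = 1" using w_mono[of p 1] p by (cases "p = 1") auto
    next
      assume "p = 1"
      then have "w t \<le> w p" if "0 \<le> t" "t \<le> 1" for t
        using w_mono[of t 1] that by (cases "t = 1") auto
      then show "\<forall>t. 0 \<le> t \<and> t \<le> 1 \<longrightarrow> V t \<le> V p"
        using le_iff greater by (auto simp: mult_le_cancel_right)
    qed
    then show ?thesis using greater by (simp add: A_pos A_neg)
  qed
qed

text \<open>The best-reply relation shared by both agents, with the opponent's probability first.
  Against \<open>q = 0\<close> every admissible \<open>p\<close> ends the game with payoff
  \<open>L\<close>, and at \<open>q = T\<close> the agent is indifferent, so neither case restricts
  \<open>p\<close>.\<close>

definition thresholds :: "real \<Rightarrow> real \<Rightarrow> real \<Rightarrow> bool" where
  "thresholds T q p \<longleftrightarrow> (p, q) \<in> profiles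
     \<and> (0 < q \<longrightarrow> (q < T \<longrightarrow> p = 1) \<and> (T < q \<longrightarrow> p = 0))"

lemma best_reply1_iff:
  assumes "S1 M y < L M y"
  shows "best_reply1 M y q p \<longleftrightarrow> thresholds ((L M y - F M y) / (L M y - S1 M y)) q p"
proof (cases "0 < q")
  case True
  have E1: "E1 M y (t, q)
      = (t * (1 - q) * L M y + q * (1 - t) * F M y + t * q * S1 M y) / (t + q - t * q)" for t
    by (simp add: E1_def a1_def a2_def aS_def add_divide_distrib)
  show ?thesis
    using True repeated_game_best_reply_iff[OF assms, of q p "F M y"]
    by (auto simp: best_reply1_def thresholds_def profiles_def E1)
next
  case False
  then show ?thesis
    by (auto simp: best_reply1_def thresholds_def profiles_def E1_def a1_def a2_def aS_def)
qed

lemma best_reply2_iff: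
  assumes "S2 M y < L M y"
  shows "best_reply2 M y p q \<longleftrightarrow> thresholds ((L M y - F M y) / (L M y - S2 M y)) p q"
proof (cases "0 < p")
  case True
  have E2: "E2 M y (p, t)
      = (t * (1 - p) * L M y + p * (1 - t) * F M y + t * p * S2 M y) / (t + p - t * p)" for t
    by (simp add: E2_def a1_def a2_def aS_def add_divide_distrib mult.commute add.commute)
  show ?thesis
    using True repeated_game_best_reply_iff[OF assms, of p q "F M y"]
    by (auto simp: best_reply2_def thresholds_def profiles_def E2)
next
  case False
  then show ?thesis
    by (auto simp: best_reply2_def thresholds_def profiles_def E2_def a1_def a2_def aS_def)
qed

text \<open>Raw material for trembles. The bound \<open>e\<close> holds at every index, because
  \<open>perfect_nash\<close> asks for best replies along the whole sequence and not merely
  eventually.\<close>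

lemma small_seq:
  fixes e :: real
  assumes "0 < e"
  obtains u :: "nat \<Rightarrow> real" where "\<And>n. 0 < u n" "\<And>n. u n < 1" "\<And>n. u n < e" "u \<longlonglongrightarrow> 0"
proof -
  define d where "d = min e 1"
  have d: "0 < d" "d \<le> e" "d \<le> 1" using assms by (auto simp: d_def)
  \<comment> \<open>\<open>n + 2\<close> keeps even the first term strictly below
    \<open>d\<close>.\<close>
  have lt: "d / real (n + 2) < d" for n
    using d by (simp add: divide_less_eq)
  have "(\<lambda>n. d / real (n + 2)) \<longlonglongrightarrow> 0"
    by real_asymp
  moreover have "d / real (n + 2) < 1" "d / real (n + 2) < e" for n
    using lt[of n] d by linarith+
  moreover have "0 < d / real (n + 2)" for n using d by simp
  ultimately show ?thesis by (intro that[of "\<lambda>n. d / real (n + 2)"])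
qed

section \<open>Equilibria for given thresholds\<close>

text \<open>The index of a threshold names the agent who plays it, not the one who reacts:
  \<open>T2\<close> is the probability of agent two that leaves agent one indifferent. Hence
  \<open>(T1, T2)\<close> is the candidate mixed equilibrium.\<close>

locale threshold_game =
  fixes M :: duopoly and y T1 T2 :: real
  assumes br1: "best_reply1 M y q p \<longleftrightarrow> thresholds T2 q p"
    and br2: "best_reply2 M y p q \<longleftrightarrow> thresholds T1 p q"
    and T_pos: "0 < T1" "0 < T2"
begin

lemma nash_iff: "(p, q) \<in> nash M y \<longleftrightarrow> thresholds T2 q p \<and> thresholds T1 p q"
  by (simp add: nash_def br1 br2)

lemma perfect_nashI:
  assumes "(p, q) \<in> nash M y"
    and "\<And>n. 0 < u n" "\<And>n. u n < 1" "u \<longlonglongrightarrow> p" "\<And>n::nat. thresholds T1 (u n) q"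
    and "\<And>n. 0 < v n" "\<And>n. v n < 1" "v \<longlonglongrightarrow> q" "\<And>n::nat. thresholds T2 (v n) p"
  shows "(p, q) \<in> perfect_nash M y"
  using assms unfolding perfect_nash_def br1 br2 by blast

text \<open>
  Trembles are below \<open>1\<close> and converge to the opponent's strategy, so they are eventually strictly
  below a threshold that exceeds this strategy or is at least \<open>1\<close>, where the best reply is unique.
\<close>

lemma perfect_nashD:
  assumes "(p, q) \<in> perfect_nash M y"
  shows "(p, q) \<in> nash M y"
    and "q < T2 \<Longrightarrow> p = 1" and "p < T1 \<Longrightarrow> q = 1"
    and "1 \<le> T2 \<Longrightarrow> p = 1" and "1 \<le> T1 \<Longrightarrow> q = 1"
proof -
  obtain u v where uv: "\<And>n::nat. 0 < u n \<and> u n < 1 \<and> 0 < v n \<and> v n < 1"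
    "u \<longlonglongrightarrow> p" "v \<longlonglongrightarrow> q" "\<And>n. thresholds T2 (v n) p" "\<And>n. thresholds T1 (u n) q"
    and nash: "(p, q) \<in> nash M y"
    using assms unfolding perfect_nash_def br1 br2 by blast
  show "(p, q) \<in> nash M y" by fact
  show "p = 1" if below: "q < T2"
  proof -
    obtain n where "v n < T2"
      using order_tendstoD(2)[OF uv(3) below] by (auto simp: eventually_sequentially)
    then show ?thesis using uv(1)[of n] uv(4)[of n] by (auto simp: thresholds_def)
  qed
  show "q = 1" if below: "p < T1"
  proof -
    obtain n where "u n < T1"
      using order_tendstoD(2)[OF uv(2) below] by (auto simp: eventually_sequentially)
    then show ?thesis using uv(1)[of n] uv(5)[of n] by (auto simp: thresholds_def)
  qed
  show "p = 1" if "1 \<le> T2"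
    using that uv(1)[of 0] uv(4)[of 0] by (auto simp: thresholds_def)
  show "q = 1" if "1 \<le> T1"
    using that uv(1)[of 0] uv(5)[of 0] by (auto simp: thresholds_def)
qed

section \<open>Perfect equilibria constructed from trembles\<close>

lemma perfect_1_0:
  assumes "T1 < 1"
  shows "(1, 0) \<in> perfect_nash M y"
proof -
  \<comment> \<open>Agent two trembles to \<open>v n\<close>, below \<open>T2\<close>, where
    \<open>1\<close> is the only reply; agent one trembles to \<open>1 - u n\<close>, above
    \<open>T1\<close>, where \<open>0\<close> is the only reply.\<close>
  obtain v :: "nat \<Rightarrow> real" where v: "\<And>n. 0 < v n" "\<And>n. v n < 1" "\<And>n. v n < T2" "v \<longlonglongrightarrow> 0"
    using small_seq[OF T_pos(2)] by blast
  obtain u :: "nat \<Rightarrow> real" where u: "\<And>n. 0 < u n" "\<And>n. u n < 1" "\<And>n. u n < 1 - T1" "u \<longlonglongrightarrow> 0"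
    using small_seq[of "1 - T1"] assms by auto
  have "\<not> 1 - u n < T1" for n
    using u(3)[of n] by simp
  moreover have "\<not> T2 < v n" for n
    using v(3)[of n] by simp
  moreover have "0 \<le> u n" "u n \<le> 1" "0 \<le> v n" "v n \<le> 1" for n
    using u(1,2)[of n] v(1,2)[of n] by auto
  ultimately show ?thesis
    using u v assms tendsto_diff[OF tendsto_const u(4), of 1]
    by (intro perfect_nashI[where u = "\<lambda>n. 1 - u n" and v = v])
      (auto simp: nash_iff thresholds_def profiles_def less_max_iff_disj)
qed

text \<open>Mirror image of \<open>perfect_1_0\<close>; here \<open>v n\<close> belongs to agent one
  and \<open>1 - u n\<close> to agent two.\<close>

lemma perfect_0_1:
  assumes "T2 < 1"
  shows "(0, 1) \<in> perfect_nash M y"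
proof -
  obtain v :: "nat \<Rightarrow> real" where v: "\<And>n. 0 < v n" "\<And>n. v n < 1" "\<And>n. v n < T1" "v \<longlonglongrightarrow> 0"
    using small_seq[OF T_pos(1)] by blast
  obtain u :: "nat \<Rightarrow> real" where u: "\<And>n. 0 < u n" "\<And>n. u n < 1" "\<And>n. u n < 1 - T2" "u \<longlonglongrightarrow> 0"
    using small_seq[of "1 - T2"] assms by auto
  have "\<not> 1 - u n < T2" for n
    using u(3)[of n] by simp
  moreover have "\<not> T1 < v n" for n
    using v(3)[of n] by simp
  moreover have "0 \<le> u n" "u n \<le> 1" "0 \<le> v n" "v n \<le> 1" for n
    using u(1,2)[of n] v(1,2)[of n] by auto
  ultimately show ?thesis
    using u v assms tendsto_diff[OF tendsto_const u(4), of 1]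
    by (intro perfect_nashI[where u = v and v = "\<lambda>n. 1 - u n"])
      (auto simp: nash_iff thresholds_def profiles_def less_max_iff_disj)
qed

text \<open>Each threshold makes the opponent indifferent and is itself completely mixed, so
  constant sequences serve as trembles.\<close>

lemma perfect_T1_T2:
  assumes "T1 < 1" "T2 < 1"
  shows "(T1, T2) \<in> perfect_nash M y"
  using assms T_pos
  by (intro perfect_nashI[where u = "\<lambda>_. T1" and v = "\<lambda>_. T2"])
    (auto simp: nash_iff thresholds_def profiles_def less_max_iff_disj)

text \<open>Every tremble \<open>1 - u n\<close> is below \<open>1\<close>, hence below both
  thresholds; this breaks the tie at a threshold equal to \<open>1\<close> in favour of
  exercise.\<close>

lemma perfect_1_1:
  assumes "1 \<le> T1" "1 \<le> T2"
  shows "(1, 1) \<in> perfect_nash M y"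
proof -
  obtain u :: "nat \<Rightarrow> real" where u: "\<And>n. 0 < u n" "\<And>n. u n < 1" "u \<longlonglongrightarrow> 0"
    using small_seq[of 1] by auto
  have "0 \<le> u n" "u n \<le> 1" "\<not> T1 < 1 - u n" "\<not> T2 < 1 - u n" for n
    using u(1,2)[of n] assms by auto
  then show ?thesis
    using u assms tendsto_diff[OF tendsto_const u(3), of 1]
    by (intro perfect_nashI[where u = "\<lambda>n. 1 - u n" and v = "\<lambda>n. 1 - u n"])
      (auto simp: nash_iff thresholds_def profiles_def less_max_iff_disj)
qed

section \<open>Exhaustive lists of equilibria\<close>

lemma nash_cases:
  assumes nash: "(p, q) \<in> nash M y" and T1: "T1 < 1"
  obtains "q = 0" "0 < p" "T1 \<le> p" | "p = 0" "0 < q" "T2 \<le> q"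
  | "p = T1" "q = T2" | "q = 1" "T2 = 1"
proof -
  have prof: "0 \<le> p \<and> 0 \<le> q \<and> (0 < p \<or> 0 < q)"
    and reply1: "0 < q \<longrightarrow> (q < T2 \<longrightarrow> p = 1) \<and> (T2 < q \<longrightarrow> p = 0)"
    and reply2: "0 < p \<longrightarrow> (p < T1 \<longrightarrow> q = 1) \<and> (T1 < p \<longrightarrow> q = 0)"
    using nash unfolding nash_iff thresholds_def profiles_def mem_Collect_eq prod.case less_max_iff_disj
    by blast+
  have "q = 0 \<and> 0 < p \<and> T1 \<le> p \<or> p = 0 \<and> 0 < q \<and> T2 \<le> q \<or> p = T1 \<and> q = T2 \<or> q = 1 \<and> T2 = 1"
  proof -
    consider (a) "q = 0" "0 < p" | (b) "p = 0" "0 < q" | (c) "0 < p" "0 < q"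
      using prof by (metis le_less)
    then show ?thesis
    proof cases
      case a
      then have "\<not> p < T1" using reply2 by auto
      then show ?thesis using a by simp
    next
      case b
      then have "\<not> q < T2" using reply1 by auto
      then show ?thesis using b by simp
    next
      case c
      \<comment> \<open>Exceeding one's own threshold drives the opponent to \<open>0\<close>, and
        \<open>q < T2\<close> would force \<open>p = 1 > T1\<close>. Hence \<open>q = T2\<close>,
        and \<open>p < T1\<close> is possible only with \<open>q = 1\<close>, the degenerate last
        case.\<close>
      have 1: "\<not> T1 < p" using reply2 c by (metis less_irrefl)
      have 2: "\<not> T2 < q" using reply1 c by (metis less_irrefl)
      have 3: "\<not> q < T2" using reply1 c T1 1 by metis
      have 4: "p < T1 \<Longrightarrow> q = 1" using reply2 c by metis
      show ?thesis
        using 1 2 3 4 by linarith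
    qed
  qed
  then show ?thesis using that by blast
qed

text \<open>The Nash equilibria outside the list are \<open>(p, 0)\<close> with
  \<open>T1 \<le> p < 1\<close> and \<open>(0, q)\<close> with \<open>T2 \<le> q < 1\<close>. They
  share the outcomes of \<open>(1, 0)\<close> and \<open>(0, 1)\<close>, so both ways of counting
  give three.\<close>

lemma both_below:
  assumes "T1 < 1" "T2 < 1"
  shows "perfect_nash M y = {(1, 0), (0, 1), (T1, T2)}"
    and "outcome ` nash M y = {outcome (1, 0), outcome (0, 1), outcome (T1, T2)}"
    and "card (perfect_nash M y) = 3" and "card (outcome ` nash M y) = 3"
proof -
  have sub: "perfect_nash M y \<subseteq> nash M y"
    by (auto simp: perfect_nash_def)
  have in_perfect: "{(1, 0), (0, 1), (T1, T2)} \<subseteq> perfect_nash M y"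
    using assms perfect_1_0 perfect_0_1 perfect_T1_T2 by auto
  show eq: "perfect_nash M y = {(1, 0), (0, 1), (T1, T2)}"
  proof
    show "perfect_nash M y \<subseteq> {(1, 0), (0, 1), (T1, T2)}"
    proof (rule subrelI)
      fix p q assume *: "(p, q) \<in> perfect_nash M y"
      show "(p, q) \<in> {(1, 0), (0, 1), (T1, T2)}"
        using perfect_nashD(1)[OF *] assms(1)
        by (cases rule: nash_cases) (use perfect_nashD(2,3)[OF *] T_pos assms in auto)
    qed
  qed (fact in_perfect)
  show out: "outcome ` nash M y = {outcome (1, 0), outcome (0, 1), outcome (T1, T2)}"
  proof
    show "outcome ` nash M y \<subseteq> {outcome (1, 0), outcome (0, 1), outcome (T1, T2)}"
    proof (rule image_subsetI)
      fix s assume s: "s \<in> nash M y"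
      obtain p q where pq: "s = (p, q)" by (cases s)
      show "outcome s \<in> {outcome (1, 0), outcome (0, 1), outcome (T1, T2)}"
        using s[unfolded pq] assms(1) unfolding pq
        by (cases rule: nash_cases)
          (use assms in \<open>auto simp: outcome_def a1_def a2_def aS_def\<close>)
    qed
  qed (use in_perfect sub in blast)
  show "card (perfect_nash M y) = 3"
    using eq assms T_pos by (simp add: card_insert_if)
  \<comment> \<open>Simultaneous exercise has positive probability only in the mixed profile, which
    separates its outcome from the two pure ones.\<close>
  have "T1 * T2 < T1" "0 < T1 * T2" using assms T_pos by simp_all
  then have "0 < T1 * T2 / (T1 + T2 - T1 * T2)"
    using T_pos by (intro divide_pos_pos) linarith+
  then have "0 < aS (T1, T2)"
    by (simp add: aS_def)
  moreover have "outcome (1, 0) = (1, 0, 0)" "outcome (0, 1) = (0, 1, 0)"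
    by (simp_all add: outcome_def a1_def a2_def aS_def)
  ultimately show "card (outcome ` nash M y) = 3"
    unfolding out by (auto simp: card_insert_if outcome_def)
qed

text \<open>Trembles below \<open>T2\<close> force \<open>p = 1\<close>, to which \<open>0\<close>
  is the only reply. At \<open>T2 = 1\<close> the profiles \<open>(p, 1)\<close> with
  \<open>0 \<le> p \<le> T1\<close> are Nash as well, hence the strict bound for the
  outcomes.\<close>

lemma only_T1_below:
  assumes "T1 < 1" "1 \<le> T2"
  shows "perfect_nash M y = {(1, 0)}"
    and "1 < T2 \<Longrightarrow> outcome ` nash M y = {outcome (1, 0)}"
proof -
  show "perfect_nash M y = {(1, 0)}"
  proof
    show "perfect_nash M y \<subseteq> {(1, 0)}"
    proof (rule subrelI)
      fix p q assume *: "(p, q) \<in> perfect_nash M y"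
      have "p = 1"
        using perfect_nashD(4)[OF *] assms(2) by simp
      moreover have "thresholds T1 p q"
        using perfect_nashD(1)[OF *] by (simp add: nash_iff)
      ultimately show "(p, q) \<in> {(1, 0)}"
        using assms(1) by (simp add: thresholds_def)
    qed
  qed (use perfect_1_0[OF assms(1)] in simp)
  assume T2: "1 < T2"
  show "outcome ` nash M y = {outcome (1, 0)}"
  proof
    show "outcome ` nash M y \<subseteq> {outcome (1, 0)}"
    proof (rule image_subsetI)
      fix s assume s: "s \<in> nash M y"
      obtain p q where pq: "s = (p, q)" by (cases s)
      have "q \<le> 1"
        using s unfolding pq nash_iff thresholds_def profiles_def by blast
      \<comment> \<open>\<open>1 < T2\<close> and \<open>q \<le> 1\<close> leave only the first case
        of \<open>nash_cases\<close>.\<close>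
      have "q = 0 \<and> 0 < p"
        using s[unfolded pq] assms(1)
        by (cases rule: nash_cases) (use T2 \<open>q \<le> 1\<close> in simp_all)
      then show "outcome s \<in> {outcome (1, 0)}"
        by (simp add: pq outcome_def a1_def a2_def aS_def)
    qed
    show "{outcome (1, 0)} \<subseteq> outcome ` nash M y"
      using perfect_nashD(1)[OF perfect_1_0[OF assms(1)]] by blast
  qed
qed

lemma none_below:
  assumes "1 \<le> T1" "1 < T2"
  shows "perfect_nash M y = {(1, 1)}" and "1 < T1 \<Longrightarrow> nash M y = {(1, 1)}"
proof -
  have "(p, q) = (1, 1)" if "(p, q) \<in> perfect_nash M y" for p q
    using perfect_nashD(4,5)[OF that] assms by simp
  then show "perfect_nash M y = {(1, 1)}"
    using perfect_1_1 assms by auto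
  assume T1: "1 < T1"
  have "(p, q) = (1, 1)" if "(p, q) \<in> nash M y" for p q
  proof -
    have prof: "0 \<le> p" "p \<le> 1" "0 \<le> q" "q \<le> 1" "0 < p \<or> 0 < q"
      and reply1: "0 < q \<longrightarrow> q < T2 \<longrightarrow> p = 1" and reply2: "0 < p \<longrightarrow> p < T1 \<longrightarrow> q = 1"
      using that unfolding nash_iff thresholds_def profiles_def mem_Collect_eq prod.case
        less_max_iff_disj by blast+
    \<comment> \<open>Both thresholds lie beyond every probability, so an agent with positive
      probability forces the other to \<open>1\<close>, which in turn forces the first to
      \<open>1\<close>.\<close>
    have "q < T2" "p < T1" using prof T1 assms by linarith+
    then show ?thesis
      using prof(5) reply1 reply2 by (metis zero_less_one)
  qed
  moreover have "(1, 1) \<in> nash M y"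
    using perfect_nashD(1)[OF perfect_1_1] assms by simp
  ultimately show "nash M y = {(1, 1)}"
    by auto
qed

end

section \<open>The value functions\<close>

locale duopoly_params =
  fixes M :: duopoly
  assumes vol: "vol M > 0" and yield: "yield M > 0" and cost: "cost M > 0"
    and D2: "0 < D2 M" and D: "D2 M < D1 M"
    and q2: "0 < q2 M" and q: "q2 M < q1 M" and qsum: "q1 M < 1 - q2 M"
begin

text \<open>
  The radicand equals \<open>a\<^sup>2 + 2 \<delta> / \<eta>\<^sup>2\<close> with \<open>a = 1/2 + (r - \<delta>) / \<eta>\<^sup>2\<close>, whatever the sign of \<open>r\<close>.
\<close>

lemma beta_gt_1: "1 < beta M"
proof -
  define k where "k = (rate M - yield M) / (vol M)\<^sup>2"
  have "2 * rate M / (vol M)\<^sup>2 = 2 * k + 2 * yield M / (vol M)\<^sup>2"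
    using vol by (simp add: k_def field_simps)
  moreover have "0 < 2 * yield M / (vol M)\<^sup>2" using vol yield by simp
  ultimately have "(1/2 + k)\<^sup>2 < (1/2 - k)\<^sup>2 + 2 * rate M / (vol M)\<^sup>2"
    by (simp add: power2_eq_square algebra_simps)
  then have "sqrt ((1/2 + k)\<^sup>2) < sqrt ((1/2 - k)\<^sup>2 + 2 * rate M / (vol M)\<^sup>2)"
    by (rule real_sqrt_less_mono)
  then have "\<bar>1/2 + k\<bar> < beta M - (1/2 - k)"
    by (simp add: beta_def k_def)
  then show ?thesis by linarith
qed

text \<open>This is \<open>D2 M * Y_F M / yield M\<close>. Measured in units of \<open>c\<close>,
  with \<open>y = x * Y_F M\<close>, the value functions depend only on \<open>x\<close>,
  \<open>beta M\<close> and \<open>d\<close>.\<close>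

definition c :: real where "c = cost M * beta M / (beta M - 1)"

definition d :: real where "d = D1 M / D2 M"

lemma c_pos: "0 < c" and d_gt_1: "1 < d"
  using beta_gt_1 cost D2 D by (auto simp: c_def d_def)

lemma Y_F_pos: "0 < Y_F M"
  using beta_gt_1 cost D2 yield by (simp add: Y_F_def)

lemma scaled_values:
  assumes "0 < x" "x < 1"
  shows "F M (x * Y_F M) = c / beta M * x powr beta M"
    and "L M (x * Y_F M) = c * (d * x - (d - 1) * x powr beta M - (beta M - 1) / beta M)"
    and "S M (x * Y_F M) = c * (x - (beta M - 1) / beta M)"
proof -
  have b: "1 < beta M" by (rule beta_gt_1)
  have x: "x * Y_F M < Y_F M" "x * Y_F M / Y_F M = x"
    using assms Y_F_pos by auto
  define e where "e = (beta M - 1) / beta M"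
  have K: "cost M = c * e"
    using b by (simp add: c_def e_def)
  have D2y: "D2 M * (x * Y_F M) / yield M = c * x"
    using b D2 yield by (simp add: c_def Y_F_def field_simps)
  have "D1 M * (x * Y_F M) / yield M = d * (D2 M * (x * Y_F M) / yield M)"
    using D2 by (simp add: d_def)
  then have D1y: "D1 M * (x * Y_F M) / yield M = d * (c * x)"
    by (simp only: D2y)
  have ratio: "(D1 M - D2 M) / D2 M = d - 1"
    using D2 by (simp add: d_def field_simps)
  show "F M (x * Y_F M) = c / beta M * x powr beta M"
    using x b by (simp add: F_def c_def)
  show "L M (x * Y_F M) = c * (d * x - (d - 1) * x powr beta M - (beta M - 1) / beta M)"
  proof -
    have "L M (x * Y_F M) = d * (c * x) - (d - 1) * c * x powr beta M - cost M"
      using x by (simp only: L_def D1y ratio c_def[symmetric] if_True)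
    then show ?thesis
      unfolding K e_def[symmetric] by (simp add: algebra_simps)
  qed
  show "S M (x * Y_F M) = c * (x - (beta M - 1) / beta M)"
    by (simp add: S_def D2y K e_def right_diff_distrib)
qed

section \<open>Ordering of the value functions below \<open>Y_F M\<close>\<close>

lemma scaled_arg:
  assumes "0 < y" "y < Y_F M"
  obtains x where "0 < x" "x < 1" "y = x * Y_F M"
  using assms that[of "y / Y_F M"] by simp

text \<open>Smooth pasting: in the scaled variable \<open>S\<close> is the tangent at
  \<open>1\<close> of the strictly convex \<open>F\<close>.\<close>

lemma S_less_F:
  assumes "0 < y" "y < Y_F M"
  shows "S M y < F M y"
proof -
  obtain x where x: "0 < x" "x < 1" "y = x * Y_F M"
    using scaled_arg[OF assms] .
  have "F M y - S M y = c / beta M * (x powr beta M - (beta M * x - (beta M - 1)))"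
    using x beta_gt_1 by (simp add: scaled_values field_simps)
  also have "\<dots> > 0"
    using x beta_gt_1 c_pos powr_gt_tangent[of "beta M" x] by simp
  finally show ?thesis by simp
qed

lemma S_less_L:
  assumes "0 < y" "y < Y_F M"
  shows "S M y < L M y"
proof -
  obtain x where x: "0 < x" "x < 1" "y = x * Y_F M"
    using scaled_arg[OF assms] .
  have "x powr beta M < x powr 1"
    using x beta_gt_1 by (intro powr_less_mono') auto
  then have "0 < c * (d - 1) * (x - x powr beta M)"
    using x c_pos d_gt_1 by simp
  also have "\<dots> = L M y - S M y"
    using x by (simp add: scaled_values algebra_simps)
  finally show ?thesis by simp
qed

text \<open>\<open>L - F\<close> is the case \<open>a = 1\<close>, \<open>s = 0\<close>, and \<open>S\<^sub>i - F\<close> the case \<open>a = q\<^sub>i\<close>, \<open>s = q\<^sub>S\<close>.\<close>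

lemma crossing:
  assumes a: "0 < a" and s: "0 \<le> s"
  defines "h \<equiv> \<lambda>y. a * (L M y - F M y) - s * (F M y - S M y)"
  obtains z where "0 < z" "z < Y_F M" "\<And>y. 0 < y \<Longrightarrow> y < z \<Longrightarrow> h y < 0" "h z = 0"
    "\<And>y. z < y \<Longrightarrow> y < Y_F M \<Longrightarrow> 0 < h y"
proof -
  define b where "b = beta M"
  \<comment> \<open>Coefficients of \<open>x\<close>, \<open>x powr b\<close> and \<open>1\<close>,
    up to sign, in \<open>h (x * Y_F M) / c\<close>, read off from
    \<open>scaled_values\<close>.\<close>
  define A B C where "A = a * d + s" and "B = a * (d - 1 + 1 / b) + s / b"
    and "C = (a + s) * ((b - 1) / b)"
  define g where "g = (\<lambda>x. A * x - B * x powr b - C)"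
  have b: "1 < b" using beta_gt_1 by (simp add: b_def)
  have "0 < B"
    using a s b d_gt_1 by (auto simp: B_def intro!: add_pos_nonneg mult_pos_pos)
  moreover have "0 < C" using a s b by (simp add: C_def)
  moreover have "A = B + C" using b by (simp add: A_def B_def C_def field_simps)
  moreover have "A < b * B"
  proof -
    \<comment> \<open>Minus the slope of \<open>g\<close> at \<open>1\<close>. The terms in
      \<open>s\<close> cancel because \<open>F - S\<close> vanishes to second order there.\<close>
    have "b * B - A = a * ((d - 1) * (b - 1))"
      using b by (simp add: A_def B_def field_simps)
    also have "\<dots> > 0" using a b d_gt_1 by simp
    finally show ?thesis by simp
  qed
  ultimately obtain z where z: "0 < z" "z < 1" "\<And>x. 0 < x \<Longrightarrow> x < z \<Longrightarrow> g x < 0" "g z = 0"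
    "\<And>x. z < x \<Longrightarrow> x < 1 \<Longrightarrow> 0 < g x"
    using powr_unimodal_crossing[of b B C A] b unfolding g_def by blast
  have h: "h (x * Y_F M) = c * g x" if "0 < x" "x < 1" for x
    using that b by (simp add: h_def scaled_values g_def A_def B_def C_def b_def[symmetric] field_simps)
  show ?thesis
  proof (rule that[of "z * Y_F M"])
    show "0 < z * Y_F M" "z * Y_F M < Y_F M" "h (z * Y_F M) = 0"
      using z Y_F_pos h by auto
    show "h y < 0" if y: "0 < y" "y < z * Y_F M" for y
    proof -
      have "z * Y_F M < Y_F M" using z Y_F_pos by simp
      then obtain x where x: "0 < x" "x < 1" "y = x * Y_F M"
        using scaled_arg[of y] y by auto
      then have "x < z" using y Y_F_pos by simp
      then show ?thesis using x h z c_pos by (simp add: mult_pos_neg)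
    qed
    show "0 < h y" if y: "z * Y_F M < y" "y < Y_F M" for y
    proof -
      have "0 < z * Y_F M" using z Y_F_pos by simp
      then obtain x where x: "0 < x" "x < 1" "y = x * Y_F M"
        using scaled_arg[of y] y by auto
      then have "z < x" using y Y_F_pos by simp
      then show ?thesis using x h z c_pos by simp
    qed
  qed
qed

section \<open>Locating \<open>Y_L\<close>, \<open>Y_1\<close> and \<open>Y_2\<close>\<close>

lemma Y_L: "0 < Y_L M" "Y_L M < Y_F M" "L M (Y_L M) = F M (Y_L M)"
  "\<And>y. Y_L M < y \<Longrightarrow> y < Y_F M \<Longrightarrow> F M y < L M y"
proof -
  obtain z where z: "0 < z" "z < Y_F M" "\<And>y. 0 < y \<Longrightarrow> y < z \<Longrightarrow> L M y < F M y" "L M z = F M z"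
    "\<And>y. z < y \<Longrightarrow> y < Y_F M \<Longrightarrow> F M y < L M y"
    using crossing[of 1 0] by auto
  have "Y_L M = z"
    unfolding Y_L_def
  proof (rule the_equality)
    show "0 < z \<and> z < Y_F M \<and> (\<forall>y. 0 < y \<and> y < z \<longrightarrow> S M y < L M y \<and> L M y < F M y)
      \<and> S M z < L M z \<and> L M z = F M z
      \<and> (\<forall>y. z < y \<and> y < Y_F M \<longrightarrow> S M y < F M y \<and> F M y < L M y)"
      using z S_less_L S_less_F by simp
  next
    fix w
    assume w: "0 < w \<and> w < Y_F M \<and> (\<forall>y. 0 < y \<and> y < w \<longrightarrow> S M y < L M y \<and> L M y < F M y)
      \<and> S M w < L M w \<and> L M w = F M w
      \<and> (\<forall>y. w < y \<and> y < Y_F M \<longrightarrow> S M y < F M y \<and> F M y < L M y)"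
    \<comment> \<open>\<open>L - F\<close> has a strict sign on either side of \<open>z\<close>, so
      \<open>L = F\<close> fails at every other point.\<close>
    then show "w = z"
      using z(3)[of w] z(5)[of w] by (cases w z rule: linorder_cases) auto
  qed
  then show "0 < Y_L M" "Y_L M < Y_F M" "L M (Y_L M) = F M (Y_L M)"
    "\<And>y. Y_L M < y \<Longrightarrow> y < Y_F M \<Longrightarrow> F M y < L M y"
    using z by auto
qed

lemma qS_pos: "0 < qS M"
  using qsum by (simp add: qS_def)

text \<open>The three weights sum to \<open>1\<close>, so \<open>F\<close> can be subtracted inside
  each term. This is the form treated by \<open>crossing\<close>.\<close>

lemma S1_minus_F: "S1 M y - F M y = q1 M * (L M y - F M y) - qS M * (F M y - S M y)"
  and S2_minus_F: "S2 M y - F M y = q2 M * (L M y - F M y) - qS M * (F M y - S M y)"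
  by (simp_all add: S1_def S2_def qS_def algebra_simps)

text \<open>\<open>T\<close> stands for \<open>S1 M\<close> or \<open>S2 M\<close>, with
  \<open>a\<close> the weight of \<open>L\<close>. At \<open>Y_L M\<close> the term
  \<open>L - F\<close> vanishes and \<open>S < F\<close> leaves \<open>T < F\<close>, which puts the
  crossing to the right of \<open>Y_L M\<close>.\<close>

lemma crossing_above_Y_L:
  assumes a: "0 < a" and T: "\<And>y. T y - F M y = a * (L M y - F M y) - qS M * (F M y - S M y)"
  defines "Z \<equiv> THE z. Y_L M < z \<and> z < Y_F M \<and> T z = F M z"
  shows "Z < Y_F M" and "T Z = F M Z" and "Y_L M < Z"
    and "\<And>y. Y_L M < y \<Longrightarrow> y < Z \<Longrightarrow> T y < F M y"
    and "\<And>y. Z < y \<Longrightarrow> y < Y_F M \<Longrightarrow> F M y < T y"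
proof -
  obtain z where z: "0 < z" "z < Y_F M" "\<And>y. 0 < y \<Longrightarrow> y < z \<Longrightarrow> T y - F M y < 0"
    "T z - F M z = 0" "\<And>y. z < y \<Longrightarrow> y < Y_F M \<Longrightarrow> 0 < T y - F M y"
    using crossing[OF a less_imp_le[OF qS_pos]] unfolding T by metis
  have "T (Y_L M) - F M (Y_L M) < 0"
    unfolding T using Y_L S_less_F qS_pos by simp
  then have Y_L_z: "Y_L M < z"
    using z(4,5) Y_L(2) by (metis less_irrefl linorder_neqE_linordered_idom order_less_asym)
  have "Z = z"
    unfolding Z_def
  proof (rule the_equality)
    show "Y_L M < z \<and> z < Y_F M \<and> T z = F M z"
      using z Y_L_z by simp
    show "w = z" if "Y_L M < w \<and> w < Y_F M \<and> T w = F M w" for w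
      using that z(3)[of w] z(5)[of w] Y_L(1) by (cases w z rule: linorder_cases) auto
  qed
  then show "Z < Y_F M" "T Z = F M Z" "Y_L M < Z"
    "\<And>y. Y_L M < y \<Longrightarrow> y < Z \<Longrightarrow> T y < F M y"
    "\<And>y. Z < y \<Longrightarrow> y < Y_F M \<Longrightarrow> F M y < T y"
    using z Y_L_z Y_L(1) by force+
qed

lemmas Y_1 = crossing_above_Y_L[of "q1 M" "S1 M", OF _ S1_minus_F, folded Y_1_def]
lemmas Y_2 = crossing_above_Y_L[of "q2 M" "S2 M", OF _ S2_minus_F, folded Y_2_def]

text \<open>At \<open>Y_1 M\<close> leading is worth more than following, so the smaller weight
  \<open>q2\<close> on \<open>L\<close> gives \<open>S2 < S1 = F\<close>: the crossing of
  \<open>S2\<close> is still to come.\<close>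

lemma Y_1_less_Y_2: "Y_1 M < Y_2 M"
proof -
  have q1: "0 < q1 M" using q2 q by simp
  have "F M (Y_1 M) < L M (Y_1 M)"
    using Y_L(4) Y_1(1,3)[OF q1] by simp
  then have "S2 M (Y_1 M) - F M (Y_1 M) < S1 M (Y_1 M) - F M (Y_1 M)"
    unfolding S1_minus_F S2_minus_F using q by simp
  then have "S2 M (Y_1 M) < F M (Y_1 M)"
    using Y_1(2)[OF q1] by simp
  then show ?thesis
    using Y_2(2,5)[OF q2] Y_1(1)[OF q1]
    by (metis less_irrefl linorder_neqE_linordered_idom order_less_asym)
qed

end

section \<open>Position of \<open>P_1\<close> and \<open>P_2\<close> relative to \<open>1\<close> in
  the three ranges of \<open>y\<close>\<close>

theorem proposition5:
  fixes M :: duopoly and y :: real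
  assumes "vol M > 0" and "yield M > 0" and "cost M > 0"
    and "0 < D2 M" and "D2 M < D1 M"
    and "0 < q2 M" and "q2 M < q1 M" and "q1 M < 1 - q2 M"
    and "Y_L M < y" and "y < Y_F M"
  shows "(y < Y_1 M \<longrightarrow>
            0 < P_1 M y \<and> P_1 M y < 1 \<and> 0 < P_2 M y \<and> P_2 M y < 1
            \<and> perfect_nash M y = {(1, 0), (0, 1), (P_1 M y, P_2 M y)}
            \<and> outcome ` nash M y = {outcome (1, 0), outcome (0, 1), outcome (P_1 M y, P_2 M y)}
            \<and> card (perfect_nash M y) = 3 \<and> card (outcome ` nash M y) = 3)
       \<and> (Y_1 M \<le> y \<and> y < Y_2 M \<longrightarrow>
            perfect_nash M y = {(1, 0)}
            \<and> (Y_1 M < y \<longrightarrow> outcome ` nash M y = {outcome (1, 0)}))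
       \<and> (Y_2 M \<le> y \<longrightarrow>
            perfect_nash M y = {(1, 1)}
            \<and> (Y_2 M < y \<longrightarrow> nash M y = {(1, 1)}))"
proof -
  interpret duopoly_params M
    using assms by unfold_locales
  have q1: "0 < q1 M" using q2 q by simp
  define l f s where "l = L M y" and "f = F M y" and "s = S M y"
  have y: "0 < y" using Y_L(1) assms by simp
  have lf: "f < l" and sl: "s < l"
    using Y_L(4) S_less_L y assms by (auto simp: l_def f_def s_def)
  \<comment> \<open>Subtracting the share \<open>q1\<close> of \<open>L\<close> in \<open>S1\<close>
    leaves the weight \<open>q2\<close> on \<open>L - F\<close>; this is why \<open>P_2\<close> has
    the denominator \<open>L - S1\<close>.\<close>
  have gap1: "l - S1 M y = q2 M * (l - f) + qS M * (l - s)"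
    and gap2: "l - S2 M y = q1 M * (l - f) + qS M * (l - s)"
    by (simp_all add: S1_def S2_def qS_def l_def f_def s_def algebra_simps)
  have gap_pos: "0 < l - S1 M y" "0 < l - S2 M y"
    unfolding gap1 gap2 using q1 q2 qS_pos lf sl by (auto intro!: add_pos_pos mult_pos_pos)
  have P: "P_1 M y = (l - f) / (l - S2 M y)" "P_2 M y = (l - f) / (l - S1 M y)"
    using sl gap_pos
    unfolding P_1_def P_2_def p0_def gap1 gap2 l_def[symmetric] f_def[symmetric] s_def[symmetric]
    by (simp_all add: divide_simps)
  interpret threshold_game M y "P_1 M y" "P_2 M y"
    using gap_pos lf
    by unfold_locales (auto simp: P l_def f_def best_reply1_iff best_reply2_iff)
  have P1_less: "P_1 M y < 1 \<longleftrightarrow> S2 M y < f" and P1_greater: "1 < P_1 M y \<longleftrightarrow> f < S2 M y"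
    and P2_less: "P_2 M y < 1 \<longleftrightarrow> S1 M y < f" and P2_greater: "1 < P_2 M y \<longleftrightarrow> f < S1 M y"
    using gap_pos by (auto simp: P)
  have below1: "P_2 M y < 1" if "y < Y_1 M"
    using that assms Y_1(4)[OF q1] by (simp add: P2_less f_def)
  have below2: "P_1 M y < 1" if "y < Y_2 M"
    using that assms Y_2(4)[OF q2] by (simp add: P1_less f_def)
  have above1: "1 < P_2 M y" if "Y_1 M < y"
    using that assms Y_1(5)[OF q1] by (simp add: P2_greater f_def)
  have above2: "1 < P_1 M y" if "Y_2 M < y"
    using that assms Y_2(5)[OF q2] by (simp add: P1_greater f_def)
  \<comment> \<open>At the crossing itself \<open>S1 = F\<close> and the threshold equals
    \<open>1\<close>, so the closed end of the range gives only a weak bound.\<close>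
  have at1: "1 \<le> P_2 M y" if "Y_1 M \<le> y"
    using that above1 Y_1(2)[OF q1] P2_less by (cases "y = Y_1 M") (auto simp: f_def not_less[symmetric])
  have at2: "1 \<le> P_1 M y" if "Y_2 M \<le> y"
    using that above2 Y_2(2)[OF q2] P1_less by (cases "y = Y_2 M") (auto simp: f_def not_less[symmetric])
  show ?thesis
  proof (intro conjI[of "_ \<longrightarrow> _"] impI)
    assume "y < Y_1 M"
    then have "P_1 M y < 1" "P_2 M y < 1"
      using below1 below2 Y_1_less_Y_2 by auto
    then show "0 < P_1 M y \<and> P_1 M y < 1 \<and> 0 < P_2 M y \<and> P_2 M y < 1
      \<and> perfect_nash M y = {(1, 0), (0, 1), (P_1 M y, P_2 M y)}
      \<and> outcome ` nash M y = {outcome (1, 0), outcome (0, 1), outcome (P_1 M y, P_2 M y)}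
      \<and> card (perfect_nash M y) = 3 \<and> card (outcome ` nash M y) = 3"
      using T_pos both_below by blast
  next
    assume "Y_1 M \<le> y \<and> y < Y_2 M"
    then show "perfect_nash M y = {(1, 0)}
      \<and> (Y_1 M < y \<longrightarrow> outcome ` nash M y = {outcome (1, 0)})"
      using only_T1_below below2 at1 above1 by blast
  next
    assume *: "Y_2 M \<le> y"
    then have "1 < P_2 M y" using above1 Y_1_less_Y_2 by simp
    then show "perfect_nash M y = {(1, 1)} \<and> (Y_2 M < y \<longrightarrow> nash M y = {(1, 1)})"
      using none_below at2 above2 * by blast
  qed
qed

end
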